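(* There exists a real-analytic two-torus $T\subset\mathbb{C}^3$ (i.e., a compact real-analytic embedded submanifold of $\mathbb{C}^3$, without boundary, diffeomorphic to $S^1\times S^1$) such that: (i) $T$ is isotropic with respect to $\omega_{\mathrm{st}}=i\sum_{j=1}^{3}dz_j\wedge d\overline{z_j}$; (ii) $T$ is not polynomially convex; and (iii) there is no holomorphic disc attached to $T$.
   Context: Let $z_1,z_2,z_3$ be the standard coordinates on $\mathbb{C}^3$, let $\mathbb{D}=\{\zeta\in\mathbb{C}:|\zeta|<1\}$ be the open unit disc, and let $\partial\mathbb{D}$ be its boundary circle. Isotropic: a submanifold $M\subset\mathbb{C}^3$ with inclusion map $\iota:M\hookrightarrow\mathbb{C}^3$ is isotropic with respect to $\omega_{\mathrm{st}}$ if $\iota^*(\omega_{\mathrm{st}})=0$. Polynomially convex: a compact set $X\subset\mathbb{C}^n$ is polynomially convex if for every $z\in\mathbb{C}^n\setminus X$ there is a holomorphic polynomial $P$ on $\mathbb{C}^n$ such that $|P(z)|>\sup_{x\in X}|P(x)|$. Attached holomorphic disc: a holomorphic disc attached to $M\subset\mathbb{C}^n$ is a nonconstant holomorphic map $\mathbb{D}\to\mathbb{C}^n$ that extends continuously to $\overline{\mathbb{D}}$ and whose extension maps $\partial\mathbb{D}$ into $M$. *)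

theory Defs
  imports "HOL-Analysis.Analysis"
begin

section \<open>Smooth and real-analytic maps between Euclidean spaces\<close>

text \<open>
  Meant for open \<open>U\<close>. The Frechet derivative is evaluated on fixed vectors so that the recursion
  stays within one type; as the domain is finite-dimensional, continuity of
  \<open>x \<mapsto> f' x v\<close> for every \<open>v\<close> is continuity of \<open>f'\<close> in the operator norm.
\<close>

primrec Ck_on ::
  "nat \<Rightarrow> 'a::euclidean_space set \<Rightarrow> ('a \<Rightarrow> 'b::euclidean_space) \<Rightarrow> bool"
where
  "Ck_on 0 U f \<longleftrightarrow> continuous_on U f"
| "Ck_on (Suc k) U f \<longleftrightarrow>
     (\<exists>f'. (\<forall>x\<in>U. (f has_derivative f' x) (at x)) \<and> (\<forall>v. Ck_on k U (\<lambda>x. f' x v)))"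

definition smooth_on_open ::
  "'a::euclidean_space set \<Rightarrow> ('a \<Rightarrow> 'b::euclidean_space) \<Rightarrow> bool"
where
  "smooth_on_open U f \<longleftrightarrow> open U \<and> (\<forall>k. Ck_on k U f)"

text \<open>On an arbitrary subset, smoothness means local extendability to a smooth map of the ambient space.\<close>

definition smooth_map_on ::
  "'a::euclidean_space set \<Rightarrow> ('a \<Rightarrow> 'b::euclidean_space) \<Rightarrow> bool"
where
  "smooth_map_on M f \<longleftrightarrow>
     (\<forall>p\<in>M. \<exists>U g. p \<in> U \<and> smooth_on_open U g \<and> (\<forall>x\<in>M \<inter> U. g x = f x))"

definition diffeomorphic ::
  "'a::euclidean_space set \<Rightarrow> 'b::euclidean_space set \<Rightarrow> bool"
where
  "diffeomorphic M N \<longleftrightarrow>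
     (\<exists>f g. f ` M = N \<and> (\<forall>x\<in>M. g (f x) = x) \<and> smooth_map_on M f \<and> smooth_map_on N g)"

text \<open>
  Multi-indices are functions on \<open>Basis\<close>. Unconditional (hence absolute) convergence of the
  multivariate power series is expressed by \<open>has_sum\<close>.
\<close>

definition real_analytic_on ::
  "('a::euclidean_space \<Rightarrow> 'b::euclidean_space) \<Rightarrow> 'a set \<Rightarrow> bool"
  (infixl \<open>real'_analytic'_on\<close> 50)
where
  "f real_analytic_on U \<longleftrightarrow>
     (\<forall>p\<in>U. \<exists>r>0. \<exists>c :: ('a \<Rightarrow> nat) \<Rightarrow> 'b. \<forall>x\<in>ball p r.
        ((\<lambda>\<alpha>. (\<Prod>b\<in>Basis. ((x - p) \<bullet> b) ^ \<alpha> b) *\<^sub>R c \<alpha>) has_sum f x)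
          (Basis \<rightarrow>\<^sub>E (UNIV :: nat set)))"


section \<open>Embedded surfaces\<close>

text \<open>
  Two-dimensional real-analytic embedded submanifolds without boundary, given by local
  parametrisations that are real-analytic immersions of open subsets of the plane and
  homeomorphisms onto relatively open subsets of \<open>M\<close>.
\<close>

definition real_analytic_surface :: "'a::euclidean_space set \<Rightarrow> bool"
where
  "real_analytic_surface M \<longleftrightarrow>
     (\<forall>p\<in>M. \<exists>U W (f :: real \<times> real \<Rightarrow> 'a) g.
        open U \<and> p \<in> U \<and> open W \<and> f real_analytic_on W \<and>
        (\<forall>u\<in>W. \<exists>f'. (f has_derivative f') (at u) \<and> inj f') \<and>
        homeomorphism W (M \<inter> U) f g)"

definition tangent_space :: "'a::euclidean_space set \<Rightarrow> 'a \<Rightarrow> 'a set"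
where
  "tangent_space M p =
     {v. \<exists>\<gamma> e. 0 < e \<and> smooth_on_open {-e<..<e} \<gamma> \<and> \<gamma> ` {-e<..<e} \<subseteq> M \<and>
           \<gamma> (0::real) = p \<and> (\<gamma> has_vector_derivative v) (at 0)}"


section \<open>Isotropy, polynomial convexity and holomorphic discs in complex Euclidean space\<close>

text \<open>
  This is \<open>\<i> * (\<Sum>j. dz\<^sub>j \<and> dz\<^sub>j\<^sup>*)\<close>, where \<open>dz\<^sub>j\<^sup>*\<close> is the conjugate of \<open>dz\<^sub>j\<close> and the wedge product
  follows the convention \<open>(\<alpha> \<and> \<beta>) v w = \<alpha> v * \<beta> w - \<alpha> w * \<beta> v\<close>.
\<close>

definition omega_st :: "complex ^ 'n \<Rightarrow> complex ^ 'n \<Rightarrow> complex"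
where
  "omega_st v w = \<i> * (\<Sum>j\<in>UNIV. v $ j * cnj (w $ j) - w $ j * cnj (v $ j))"

definition isotropic :: "(complex ^ 'n) set \<Rightarrow> bool"
where
  "isotropic M \<longleftrightarrow>
     (\<forall>p\<in>M. \<forall>v\<in>tangent_space M p. \<forall>w\<in>tangent_space M p. omega_st v w = 0)"

definition holomorphic_polynomial :: "(complex ^ 'n \<Rightarrow> complex) \<Rightarrow> bool"
where
  "holomorphic_polynomial P \<longleftrightarrow>
     (\<exists>(A :: ('n \<Rightarrow> nat) set) c. finite A \<and>
        P = (\<lambda>z. \<Sum>\<alpha>\<in>A. c \<alpha> * (\<Prod>j\<in>UNIV. (z $ j) ^ \<alpha> j)))"

text \<open>
  Meant for compact \<open>X\<close>. Constant polynomials make the empty set convex, whatever the value of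
  the supremum over it.
\<close>

definition polynomially_convex :: "(complex ^ 'n) set \<Rightarrow> bool"
where
  "polynomially_convex X \<longleftrightarrow>
     (\<forall>z. z \<notin> X \<longrightarrow>
        (\<exists>P. holomorphic_polynomial P \<and> cmod (P z) > (SUP x\<in>X. cmod (P x))))"

definition attached_holomorphic_disc ::
  "(complex ^ 'n) set \<Rightarrow> (complex \<Rightarrow> complex ^ 'n) \<Rightarrow> bool"
where
  "attached_holomorphic_disc M f \<longleftrightarrow>
     (\<forall>j. (\<lambda>\<zeta>. f \<zeta> $ j) holomorphic_on ball 0 1) \<and>
     \<not> f constant_on ball 0 1 \<and>
     (\<exists>F. continuous_on (cball 0 1) F \<and> (\<forall>\<zeta>\<in>ball 0 1. F \<zeta> = f \<zeta>) \<and> F ` sphere 0 1 \<subseteq> M)"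

end

theory Submission
  imports Defs "HOL-Complex_Analysis.Conformal_Mappings"
begin

text \<open>
  The torus is the union of the orbits of the circle action with weights \<open>(2, - 2, 1)\<close> through the
  curve \<open>(3 (h - 6), h - 54, 4 k)\<close>, where \<open>h = X + 4 / X\<close>, \<open>k = X - 4 / X\<close> and \<open>X\<close> runs over the
  circle of radius \<open>4\<close>. The constants are chosen such that the moment map
  \<open>2 |z\<^sub>1|\<^sup>2 - 2 |z\<^sub>2|\<^sup>2 + |z\<^sub>3|\<^sup>2\<close> is constant on the curve, so the torus is isotropic.

  Replacing \<open>X\<close> by \<open>4 / X\<close> changes the sign of \<open>k\<close> only, which is the action of \<open>- 1\<close>. Hence the
  same formula on the annulus \<open>1 \<le> |X| \<le> 4\<close> has both boundary circles on the torus, and the maximum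
  principle puts the annulus into the polynomial hull.

  Along an attached disc the product \<open>z\<^sub>1 z\<^sub>2\<close> determines a holomorphic extension of \<open>h\<close> with values
  bounded by \<open>5\<close>. Then \<open>z\<^sub>2 / (h - 54)\<close> has no zeros and is unimodular on the circle, so it is
  constant. Therefore \<open>h\<^sup>2 - 16\<close> is the square of a holomorphic function, and the disc lifts to a
  zero-free function \<open>X\<close>, whose modulus on the circle is \<open>1\<close> or \<open>4\<close>, by connectedness only one of
  the two. So \<open>X\<close>, and with it the disc, is constant. Geometrically, the quotient by the circle
  action is a disc with two orbifold points of order two, which is covered by the annulus but by no
  disc.
\<close>

section \<open>Calculus of smooth maps\<close>

lemma Ck_on_subset: "Ck_on k V f \<Longrightarrow> U \<subseteq> V \<Longrightarrow> Ck_on k U f"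
proof (induction k arbitrary: f)
  case 0
  then show ?case by (auto intro: continuous_on_subset)
next
  case (Suc k)
  from Suc.prems(1) obtain f' where
    f': "\<forall>x\<in>V. (f has_derivative f' x) (at x)" "\<forall>v. Ck_on k V (\<lambda>x. f' x v)"
    by auto
  have "\<forall>v. Ck_on k U (\<lambda>x. f' x v)" using f'(2) Suc.IH Suc.prems(2) by blast
  with f'(1) Suc.prems(2) show ?case by auto
qed

text \<open>The Leibniz rule and the rule for inverses contain the undifferentiated functions, so
  the inductions for products and inverses need these at the lower order as well.\<close>

lemma Ck_on_SucD: "Ck_on (Suc k) U f \<Longrightarrow> Ck_on k U f"
proof (induction k arbitrary: f)
  case 0
  then show ?case
    unfolding Ck_on.simps by (meson continuous_at_imp_continuous_on has_derivative_continuous)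
next
  case (Suc k)
  from Suc.prems obtain f' where
    f': "\<forall>x\<in>U. (f has_derivative f' x) (at x)" "\<forall>v. Ck_on (Suc k) U (\<lambda>x. f' x v)"
    unfolding Ck_on.simps(2)[of "Suc k"] by blast
  have "\<forall>v. Ck_on k U (\<lambda>x. f' x v)" using f'(2) Suc.IH by blast
  with f'(1) show ?case by auto
qed

lemma Ck_on_const: "Ck_on k U (\<lambda>x. c)"
proof (induction k arbitrary: c)
  case (Suc k)
  have "\<forall>x\<in>U. ((\<lambda>x. c) has_derivative (\<lambda>x v. 0) x) (at x)" by simp
  with Suc show ?case unfolding Ck_on.simps by (intro exI[of _ "\<lambda>x v. 0"]) auto
qed simp

lemma Ck_on_bounded_linear_compose:
  assumes "bounded_linear L" "Ck_on k U f"
  shows "Ck_on k U (\<lambda>x. L (f x))"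
  using assms(2)
proof (induction k arbitrary: f)
  case 0
  then show ?case by (auto intro: bounded_linear.continuous_on[OF assms(1)])
next
  case (Suc k)
  from Suc.prems obtain f' where
    f': "\<forall>x\<in>U. (f has_derivative f' x) (at x)" "\<forall>v. Ck_on k U (\<lambda>x. f' x v)"
    by auto
  have "\<forall>x\<in>U. ((\<lambda>x. L (f x)) has_derivative (\<lambda>v. L (f' x v))) (at x)"
    using f'(1) bounded_linear.has_derivative[OF assms(1)] by blast
  moreover have "\<forall>v. Ck_on k U (\<lambda>x. L (f' x v))" using f'(2) Suc.IH by blast
  ultimately show ?case unfolding Ck_on.simps by (intro exI[of _ "\<lambda>x v. L (f' x v)"]) auto
qed

lemma Ck_on_bounded_linear:
  assumes "bounded_linear L"
  shows "Ck_on k U L"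
proof (cases k)
  case 0
  then show ?thesis by (simp add: linear_continuous_on[OF assms])
next
  case (Suc j)
  have "\<forall>x\<in>U. (L has_derivative (\<lambda>x. L) x) (at x)"
    by (simp add: bounded_linear_imp_has_derivative[OF assms])
  then show ?thesis unfolding Suc Ck_on.simps using Ck_on_const[of j U] by (intro exI[of _ "\<lambda>x. L"]) auto
qed

lemma Ck_on_add:
  assumes "Ck_on k U f" "Ck_on k U g"
  shows "Ck_on k U (\<lambda>x. f x + g x)"
  using assms
proof (induction k arbitrary: f g)
  case 0
  then show ?case by (auto intro: continuous_intros)
next
  case (Suc k)
  from Suc.prems(1) obtain f' where
    f': "\<forall>x\<in>U. (f has_derivative f' x) (at x)" "\<forall>v. Ck_on k U (\<lambda>x. f' x v)" by auto
  from Suc.prems(2) obtain g' where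
    g': "\<forall>x\<in>U. (g has_derivative g' x) (at x)" "\<forall>v. Ck_on k U (\<lambda>x. g' x v)" by auto
  have "\<forall>x\<in>U. ((\<lambda>x. f x + g x) has_derivative (\<lambda>v. f' x v + g' x v)) (at x)"
    using f'(1) g'(1) by (blast intro: has_derivative_add)
  moreover have "\<forall>v. Ck_on k U (\<lambda>x. f' x v + g' x v)" using f'(2) g'(2) Suc.IH by blast
  ultimately show ?case unfolding Ck_on.simps
    by (intro exI[of _ "\<lambda>x v. f' x v + g' x v"]) auto
qed

lemma Ck_on_diff:
  assumes "Ck_on k U f" "Ck_on k U g"
  shows "Ck_on k U (\<lambda>x. f x - g x)"
  using Ck_on_add[OF assms(1) Ck_on_bounded_linear_compose[OF _ assms(2), of uminus]]
  by (simp add: bounded_linear_minus bounded_linear_ident)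

lemma Ck_on_mult:
  fixes f g :: "'a::euclidean_space \<Rightarrow> 'b::{euclidean_space, real_normed_algebra}"
  assumes "Ck_on k U f" "Ck_on k U g"
  shows "Ck_on k U (\<lambda>x. f x * g x)"
  using assms
proof (induction k arbitrary: f g)
  case 0
  then show ?case by (auto intro: continuous_intros)
next
  case (Suc k)
  from Suc.prems(1) obtain f' where
    f': "\<forall>x\<in>U. (f has_derivative f' x) (at x)" "\<forall>v. Ck_on k U (\<lambda>x. f' x v)" by auto
  from Suc.prems(2) obtain g' where
    g': "\<forall>x\<in>U. (g has_derivative g' x) (at x)" "\<forall>v. Ck_on k U (\<lambda>x. g' x v)" by auto
  have fg: "Ck_on k U f" "Ck_on k U g" using Suc.prems Ck_on_SucD by blast+
  have "((\<lambda>x. f x * g x) has_derivative (\<lambda>v. f x * g' x v + f' x v * g x)) (at x)" if "x \<in> U" for x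
    by (rule has_derivative_mult[OF bspec[OF f'(1) that] bspec[OF g'(1) that]])
  moreover have "Ck_on k U (\<lambda>x. f x * g' x v + f' x v * g x)" for v
    by (rule Ck_on_add[OF Suc.IH[OF fg(1) spec[OF g'(2)]] Suc.IH[OF spec[OF f'(2)] fg(2)]])
  ultimately show ?case unfolding Ck_on.simps
    by (intro exI[of _ "\<lambda>x v. f x * g' x v + f' x v * g x"] conjI ballI allI)
qed

text \<open>The derivative of 1 / f is again built from 1 / f and f', and the induction hypothesis
  provides 1 / f at order k.\<close>

lemma Ck_on_inverse:
  fixes f :: "'a::euclidean_space \<Rightarrow> 'b::{euclidean_space, real_normed_field}"
  assumes "Ck_on k U f" "\<And>x. x \<in> U \<Longrightarrow> f x \<noteq> 0"
  shows "Ck_on k U (\<lambda>x. inverse (f x))"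
  using assms(1)
proof (induction k)
  case 0
  then show ?case using assms(2) by (auto intro: continuous_intros)
next
  case (Suc k)
  from Suc.prems(1) obtain f' where
    f': "\<forall>x\<in>U. (f has_derivative f' x) (at x)" "\<forall>v. Ck_on k U (\<lambda>x. f' x v)" by auto
  have inv: "Ck_on k U (\<lambda>x. inverse (f x))" using Suc.IH Suc.prems Ck_on_SucD by blast
  have "((\<lambda>x. inverse (f x)) has_derivative
      (\<lambda>v. - (inverse (f x) * f' x v * inverse (f x)))) (at x)" if "x \<in> U" for x
    by (rule Deriv.has_derivative_inverse[OF assms(2)[OF that] bspec[OF f'(1) that]])
  moreover have "Ck_on k U (\<lambda>x. - (inverse (f x) * f' x v * inverse (f x)))" for v
    by (rule Ck_on_bounded_linear_compose[OF bounded_linear_minus[OF bounded_linear_ident]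
          Ck_on_mult[OF Ck_on_mult[OF inv spec[OF f'(2)]] inv]])
  ultimately show ?case unfolding Ck_on.simps
    by (intro exI[of _ "\<lambda>x v. - (inverse (f x) * f' x v * inverse (f x))"] conjI ballI allI)
qed

lemma Ck_on_divide:
  fixes f :: "'a::euclidean_space \<Rightarrow> 'b::{euclidean_space, real_normed_field}"
  assumes "Ck_on k U f" "Ck_on k U g" "\<And>x. x \<in> U \<Longrightarrow> g x \<noteq> 0"
  shows "Ck_on k U (\<lambda>x. f x / g x)"
  using Ck_on_mult[OF assms(1) Ck_on_inverse[OF assms(2,3)]] by (simp add: divide_inverse)

lemma Ck_on_cnj: "Ck_on k U f \<Longrightarrow> Ck_on k U (\<lambda>x. cnj (f x))"
  by (rule Ck_on_bounded_linear_compose[OF bounded_linear_cnj])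

lemma Ck_on_Pair:
  assumes "Ck_on k U f" "Ck_on k U g"
  shows "Ck_on k U (\<lambda>x. (f x, g x))"
proof -
  have "bounded_linear (\<lambda>a::'b. (a, 0::'c))" "bounded_linear (\<lambda>b::'c. (0::'b, b))"
    by (auto intro!: bounded_linear_Pair bounded_linear_ident bounded_linear_zero)
  from Ck_on_add[OF Ck_on_bounded_linear_compose[OF this(1) assms(1)]
      Ck_on_bounded_linear_compose[OF this(2) assms(2)]]
  show ?thesis by simp
qed

lemma bounded_linear_axis: "bounded_linear (axis i :: 'a::euclidean_space \<Rightarrow> 'a ^ 'n)"
  unfolding linear_conv_bounded_linear[symmetric]
  by (rule linearI) (auto simp: vec_eq_iff axis_def)

text \<open>In this form \<open>vector\<close> is a sum of linear images of its entries, so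
  smoothness of a vector-valued map reduces to that of its coordinates.\<close>

lemma vector_3_axis:
  fixes a b c :: "'a::monoid_add"
  shows "(vector [a, b, c] :: 'a ^ 3) = axis 1 a + axis 2 b + axis 3 c"
  by (simp add: vec_eq_iff forall_3 axis_def)

lemma Ck_on_vector_3:
  fixes f g h :: "'a::euclidean_space \<Rightarrow> 'b::euclidean_space"
  assumes "Ck_on k U f" "Ck_on k U g" "Ck_on k U h"
  shows "Ck_on k U (\<lambda>x. vector [f x, g x, h x] :: 'b ^ 3)"
  unfolding vector_3_axis
  by (intro Ck_on_add Ck_on_bounded_linear_compose[OF bounded_linear_axis] assms)

lemmas Ck_on_intros = Ck_on_const Ck_on_bounded_linear[OF bounded_linear_fst]
  Ck_on_bounded_linear[OF bounded_linear_snd] Ck_on_bounded_linear[OF bounded_linear_vec_nth]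
  Ck_on_add Ck_on_diff Ck_on_mult Ck_on_cnj Ck_on_vector_3 Ck_on_Pair


section \<open>The torus\<close>

text \<open>For \<tau> on the unit circle and X = 4 * \<tau> one has 4 / X = cnj \<tau>, so h = 4 *
  \<tau> + cnj \<tau> and k = 4 * \<tau> - cnj \<tau>. Conjugates in place of inverses make the map
  polynomial in real coordinates, hence smooth on the whole space.\<close>

definition torus_map :: "complex \<times> complex \<Rightarrow> complex ^ 3" where
  "torus_map p = (case p of (\<sigma>, \<tau>) \<Rightarrow>
     vector [3 * (\<sigma> * \<sigma> * (4 * \<tau> + cnj \<tau> - 6)), cnj \<sigma> * cnj \<sigma> * (4 * \<tau> + cnj \<tau> - 54),
             4 * (\<sigma> * (4 * \<tau> - cnj \<tau>))])"

definition torus :: "(complex ^ 3) set" where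
  "torus = torus_map ` (sphere 0 1 \<times> sphere 0 1)"

text \<open>
  A smooth left inverse of \<open>torus_map\<close>. For \<open>c = Re \<tau>\<close> one computes
  \<open>cmod z\<^sub>1 ^ 2 / 9 - cmod z\<^sub>2 ^ 2 = 480 * c - 2880\<close> and \<open>Im (z\<^sub>1 * z\<^sub>2) = 90 * (c - 6) * Im \<tau>\<close>.
\<close>

definition re_coord :: "complex ^ 3 \<Rightarrow> complex" where
  "re_coord z = (z $ 1 * cnj (z $ 1) / 9 - z $ 2 * cnj (z $ 2) + 2880) / 480"

definition tau_coord :: "complex ^ 3 \<Rightarrow> complex" where
  "tau_coord z = re_coord z + (z $ 1 * z $ 2 - cnj (z $ 1 * z $ 2)) / (180 * (re_coord z - 6))"

definition sigma_coord :: "complex ^ 3 \<Rightarrow> complex" where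
  "sigma_coord z = z $ 3 / (4 * (4 * tau_coord z - cnj (tau_coord z)))"

definition torus_inv :: "complex ^ 3 \<Rightarrow> complex \<times> complex" where
  "torus_inv z = (sigma_coord z, tau_coord z)"

text \<open>The denominators of \<open>tau_coord\<close> and \<open>sigma_coord\<close> have no
  zeros here, so this is a neighbourhood of the torus on which \<open>torus_inv\<close> is
  smooth.\<close>

definition torus_nbhd :: "(complex ^ 3) set" where
  "torus_nbhd = {z. re_coord z \<noteq> 6 \<and> 4 * tau_coord z - cnj (tau_coord z) \<noteq> 0}"

section \<open>The parametrisation of the torus and its inverse\<close>

lemma torus_map_nth [simp]:
  "torus_map (\<sigma>, \<tau>) $ 1 = 3 * (\<sigma> * \<sigma> * (4 * \<tau> + cnj \<tau> - 6))"
  "torus_map (\<sigma>, \<tau>) $ 2 = cnj \<sigma> * cnj \<sigma> * (4 * \<tau> + cnj \<tau> - 54)"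
  "torus_map (\<sigma>, \<tau>) $ 3 = 4 * (\<sigma> * (4 * \<tau> - cnj \<tau>))"
  by (simp_all add: torus_map_def)

lemma torusE:
  assumes "z \<in> torus"
  obtains \<sigma> \<tau> where "cmod \<sigma> = 1" "cmod \<tau> = 1" "z = torus_map (\<sigma>, \<tau>)"
  using assms by (auto simp: torus_def)

lemma torusI: "cmod \<sigma> = 1 \<Longrightarrow> cmod \<tau> = 1 \<Longrightarrow> torus_map (\<sigma>, \<tau>) \<in> torus"
  by (auto simp: torus_def)

lemma unit_mult_cnj: "cmod z = 1 \<Longrightarrow> z * cnj z = 1"
  by (metis complex_norm_square mult_1 norm_one of_real_1 power2_eq_square)

text \<open>The two terms have moduli 4 and 1. Consequently the third coordinate has no zeros on the
  torus.\<close>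

lemma unit_four_diff_nonzero: "cmod \<tau> = 1 \<Longrightarrow> 4 * \<tau> - cnj \<tau> \<noteq> 0"
  by (metis complex_mod_cnj eq_iff_diff_eq_0 mult.right_neutral norm_mult norm_numeral numeral_eq_one_iff semiring_norm(83))

lemma coords_torus_map:
  assumes "cmod \<sigma> = 1" "cmod \<tau> = 1"
  shows "re_coord (torus_map (\<sigma>, \<tau>)) = (\<tau> + cnj \<tau>) / 2" (is ?c)
    and "re_coord (torus_map (\<sigma>, \<tau>)) \<noteq> 6" (is ?n)
    and "tau_coord (torus_map (\<sigma>, \<tau>)) = \<tau>" (is ?t)
    and "sigma_coord (torus_map (\<sigma>, \<tau>)) = \<sigma>" (is ?s)
proof -
  define s t where "s = cnj \<sigma>" and "t = cnj \<tau>"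
  have cj: "cnj \<sigma> = s" "cnj \<tau> = t" "cnj s = \<sigma>" "cnj t = \<tau>" by (simp_all add: s_def t_def)
  have st: "\<sigma> * s = 1" "\<tau> * t = 1" using assms by (simp_all add: s_def t_def unit_mult_cnj)
  \<comment> \<open>The identities \<open>c1\<close>, \<open>c2\<close> and \<open>w\<close> are
    polynomial in \<sigma>, s, \<tau>, t as independent variables; the relations \<sigma> * s = 1
    and \<tau> * t = 1 enter only through the explicit factors \<open>\<sigma> * s\<close> and
    \<open>\<tau> * t - 1\<close>.\<close>
  have c1: "3 * (\<sigma> * \<sigma> * (4 * \<tau> + t - 6)) * (3 * (s * s * (4 * t + \<tau> - 6)))
      = 9 * ((\<sigma> * s)\<^sup>2 * (17 + 4 * (\<tau>\<^sup>2 + t\<^sup>2) - 30 * (\<tau> + t) + 36 + 17 * (\<tau> * t - 1)))"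
    by (simp add: algebra_simps power2_eq_square)
  have c2: "s * s * (4 * \<tau> + t - 54) * (\<sigma> * \<sigma> * (4 * t + \<tau> - 54))
      = (\<sigma> * s)\<^sup>2 * (17 + 4 * (\<tau>\<^sup>2 + t\<^sup>2) - 270 * (\<tau> + t) + 2916 + 17 * (\<tau> * t - 1))"
    by (simp add: algebra_simps power2_eq_square)
  have c: "re_coord (torus_map (\<sigma>, \<tau>)) = (\<tau> + t) / 2"
    unfolding re_coord_def torus_map_nth cj complex_cnj_mult complex_cnj_diff complex_cnj_add
      complex_cnj_numeral cj c1 c2 st
    by (simp add: field_simps)
  then show ?c by (simp add: cj)
  have "cmod ((\<tau> + t) / 2) \<le> 1"
    using norm_triangle_ineq[of \<tau> "cnj \<tau>"] assms(2) by (simp add: norm_divide t_def)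
  then show n: ?n using c by fastforce
  have w: "3 * (\<sigma> * \<sigma> * (4 * \<tau> + t - 6)) * (s * s * (4 * \<tau> + t - 54))
      - 3 * (s * s * (4 * t + \<tau> - 6)) * (\<sigma> * \<sigma> * (4 * t + \<tau> - 54))
      = (\<sigma> * s)\<^sup>2 * (90 * (\<tau> - t) * ((\<tau> + t) / 2 - 6))"
    by (simp add: field_simps power2_eq_square)
  have "tau_coord (torus_map (\<sigma>, \<tau>)) = (\<tau> + t) / 2 + (90 * (\<tau> - t) * ((\<tau> + t) / 2 - 6)) / (180 * ((\<tau> + t) / 2 - 6))"
    unfolding tau_coord_def c torus_map_nth complex_cnj_mult complex_cnj_diff complex_cnj_add
      complex_cnj_numeral cj w st by simp
  also have "\<dots> = \<tau>"
  proof -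
    define d where "d = (\<tau> + t) / 2 - 6"
    have "d \<noteq> 0" using n c by (simp add: d_def)
    then show ?thesis unfolding d_def[symmetric] by (simp add: field_simps)
  qed
  finally show t: ?t .
  have "4 * (\<sigma> * d) / (4 * d) = \<sigma>" if "d \<noteq> 0" for d using that by simp
  note this[OF unit_four_diff_nonzero[OF assms(2)]]
  then show ?s unfolding sigma_coord_def t torus_map_nth .
qed

lemma torus_inv_map: "cmod \<sigma> = 1 \<Longrightarrow> cmod \<tau> = 1 \<Longrightarrow> torus_inv (torus_map (\<sigma>, \<tau>)) = (\<sigma>, \<tau>)"
  by (simp add: torus_inv_def coords_torus_map)

lemma torus_map_inv: "z \<in> torus \<Longrightarrow> torus_map (torus_inv z) = z"
  by (auto elim!: torusE simp: torus_inv_map)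

lemma cmod_coords:
  "z \<in> torus \<Longrightarrow> cmod (sigma_coord z) = 1 \<and> cmod (tau_coord z) = 1"
  by (auto elim!: torusE simp: coords_torus_map)

lemma torus_subset_nbhd: "torus \<subseteq> torus_nbhd"
  using coords_torus_map(2,3) unit_four_diff_nonzero by (auto elim!: torusE simp: torus_nbhd_def)

lemma smooth_torus_map: "smooth_on_open UNIV torus_map"
proof -
  have "torus_map = (\<lambda>p. vector [3 * (fst p * fst p * (4 * snd p + cnj (snd p) - 6)),
      cnj (fst p) * cnj (fst p) * (4 * snd p + cnj (snd p) - 54),
             4 * (fst p * (4 * snd p - cnj (snd p)))])"
    by (simp add: torus_map_def fun_eq_iff split: prod.split)
  moreover have "Ck_on k UNIV \<dots>" for k by (intro Ck_on_intros)
  ultimately show ?thesis unfolding smooth_on_open_def by simp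
qed

lemma continuous_on_smooth: "smooth_on_open U f \<Longrightarrow> continuous_on U f"
  unfolding smooth_on_open_def by (metis Ck_on.simps(1))

lemma has_derivative_smooth:
  assumes "smooth_on_open U f" "x \<in> U"
  obtains f' where "(f has_derivative f') (at x)"
proof -
  have "Ck_on (Suc 0) U f" using assms(1) unfolding smooth_on_open_def by blast
  then show ?thesis using assms(2) that unfolding Ck_on.simps by blast
qed

lemma smooth_torus_inv: "smooth_on_open torus_nbhd torus_inv"
proof -
  have c: "Ck_on k U re_coord" for k U
    unfolding re_coord_def[abs_def] by (intro Ck_on_intros Ck_on_divide) auto
  \<comment> \<open>The second condition defining \<open>torus_nbhd\<close> involves
    \<open>tau_coord\<close>, which is known to be continuous only off the zeros of its denominator.
    Openness is therefore shown in two stages.\<close>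
  define V where "V = {z. re_coord z \<noteq> 6}"
  have "continuous_on UNIV re_coord" using c[of 0] by simp
  then have V: "open V" unfolding V_def
    by (rule open_Collect_neq[OF _ continuous_on_const])
  have t: "Ck_on k V tau_coord" for k
    unfolding tau_coord_def[abs_def] by (intro Ck_on_intros Ck_on_divide c) (auto simp: V_def)
  have eq: "torus_nbhd = V \<inter> (\<lambda>z. 4 * tau_coord z - cnj (tau_coord z)) -` (- {0})"
    by (auto simp: torus_nbhd_def V_def)
  have "continuous_on V (\<lambda>z. 4 * tau_coord z - cnj (tau_coord z))"
    by (intro continuous_intros t[of 0, unfolded Ck_on.simps])
  then have o: "open torus_nbhd"
    unfolding eq by (rule continuous_open_preimage[OF _ V]) (simp add: open_Compl)
  have t': "Ck_on k torus_nbhd tau_coord" for k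
    using Ck_on_subset[OF t] eq by blast
  have "Ck_on k torus_nbhd sigma_coord" for k
    unfolding sigma_coord_def[abs_def] by (intro Ck_on_intros Ck_on_divide t') (auto simp: torus_nbhd_def)
  then show ?thesis
    unfolding smooth_on_open_def torus_inv_def[abs_def] by (intro conjI allI o Ck_on_Pair t')
qed

lemma compact_torus: "compact torus"
  unfolding torus_def
  by (intro compact_continuous_image continuous_on_subset[OF continuous_on_smooth[OF smooth_torus_map]]
      compact_Times) auto

lemma diffeomorphic_torus: "diffeomorphic (sphere (0::complex) 1 \<times> sphere (0::complex) 1) torus"
  unfolding diffeomorphic_def
proof (intro exI conjI)
  show "torus_map ` (sphere 0 1 \<times> sphere 0 1) = torus" by (simp add: torus_def)
  show "\<forall>x\<in>sphere 0 1 \<times> sphere 0 1. torus_inv (torus_map x) = x"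
    by (auto simp: torus_inv_map)
  show "smooth_map_on (sphere 0 1 \<times> sphere 0 1) torus_map"
    unfolding smooth_map_on_def using smooth_torus_map by blast
  show "smooth_map_on torus torus_inv"
    unfolding smooth_map_on_def using smooth_torus_inv torus_subset_nbhd by blast
qed

section \<open>Tangent vectors and isotropy\<close>

text \<open>Differentiating s * cnj s = 1 shows that s' * cnj (s 0) is purely imaginary.\<close>

lemma unit_curve_derivative:
  fixes s :: "real \<Rightarrow> complex"
  assumes "(s has_vector_derivative s') (at 0)" "0 < e" "\<And>t. t \<in> {-e<..<e} \<Longrightarrow> cmod (s t) = 1"
  shows "\<exists>a::real. s' = \<i> * of_real a * s 0"
proof -
  have "((\<lambda>t. s t * cnj (s t)) has_vector_derivative s 0 * cnj s' + s' * cnj (s 0)) (at 0)"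
    by (intro has_vector_derivative_mult assms(1) has_vector_derivative_cnj)
  moreover have "((\<lambda>t. s t * cnj (s t)) has_vector_derivative 0) (at 0)"
  proof (rule has_vector_derivative_transform_within_open)
    show "((\<lambda>t. 1::complex) has_vector_derivative 0) (at (0::real))" by simp
    show "open {-e<..<e}" "0 \<in> {-e<..<e}" using assms(2) by auto
  qed (simp add: assms(3) unit_mult_cnj)
  ultimately have "s 0 * cnj s' + s' * cnj (s 0) = 0"
    by (rule vector_derivative_unique_at)
  then have "Re (s' * cnj (s 0)) = 0" by (auto simp: complex_eq_iff)
  then have "s' * cnj (s 0) = \<i> * of_real (Im (s' * cnj (s 0)))"
    by (auto simp: complex_eq_iff)
  moreover have "s' = (s' * cnj (s 0)) * s 0"
    using unit_mult_cnj[of "s 0"] assms by (simp add: mult.assoc mult.commute[of "cnj (s 0)"])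
  ultimately show ?thesis by metis
qed

text \<open>Through \<open>torus_inv\<close> a curve in the torus becomes a pair of curves in the
  unit circle. Their angular velocities at 0 are a and b, and the product rule for
  \<open>torus_map\<close> along this pair gives the coordinates of v.\<close>

lemma tangent_space_torus:
  assumes v: "v \<in> tangent_space torus (torus_map (\<sigma>, \<tau>))" and st: "cmod \<sigma> = 1" "cmod \<tau> = 1"
  shows "\<exists>a b::real. v $ 1 = 3 * \<i> * \<sigma>\<^sup>2 * (2 * complex_of_real a * (4 * \<tau> + cnj \<tau> - 6) + complex_of_real b * (4 * \<tau> - cnj \<tau>)) \<and>
      v $ 2 = \<i> * (cnj \<sigma>)\<^sup>2 * (- 2 * complex_of_real a * (4 * \<tau> + cnj \<tau> - 54) + complex_of_real b * (4 * \<tau> - cnj \<tau>)) \<and>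
      v $ 3 = 4 * \<i> * \<sigma> * (complex_of_real a * (4 * \<tau> - cnj \<tau>) + complex_of_real b * (4 * \<tau> + cnj \<tau>))"
proof -
  from v obtain \<gamma> e where e: "0 < e" and \<gamma>: "\<gamma> ` {-e<..<e} \<subseteq> torus"
    "\<gamma> 0 = torus_map (\<sigma>, \<tau>)" "(\<gamma> has_vector_derivative v) (at 0)"
    unfolding tangent_space_def by blast
  define s t where "s x = sigma_coord (\<gamma> x)" and "t x = tau_coord (\<gamma> x)" for x
  have "\<gamma> 0 \<in> torus_nbhd" using torus_subset_nbhd torusI[OF st] \<gamma>(2) by auto
  then obtain L where L: "(torus_inv has_derivative L) (at (\<gamma> 0))"
    using has_derivative_smooth[OF smooth_torus_inv] by blast
  have "((\<lambda>x. torus_inv (\<gamma> x)) has_vector_derivative L v) (at 0)"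
    using vector_derivative_diff_chain_within[OF \<gamma>(3) has_derivative_at_withinI[OF L]]
    by (simp add: o_def)
  then have d: "(s has_vector_derivative fst (L v)) (at 0)" "(t has_vector_derivative snd (L v)) (at 0)"
    unfolding s_def[abs_def] t_def[abs_def] torus_inv_def
    by (auto dest: bounded_linear.has_vector_derivative[OF bounded_linear_fst]
      bounded_linear.has_vector_derivative[OF bounded_linear_snd])
  have s0: "s 0 = \<sigma>" "t 0 = \<tau>" using st \<gamma>(2) by (simp_all add: s_def t_def coords_torus_map)
  have un: "cmod (s x) = 1" "cmod (t x) = 1" if "x \<in> {-e<..<e}" for x
    using cmod_coords \<gamma>(1) that unfolding s_def t_def by blast+
  obtain a b :: real where ab: "fst (L v) = \<i> * of_real a * \<sigma>" "snd (L v) = \<i> * of_real b * \<tau>"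
    using unit_curve_derivative[OF d(1) e un(1)] unit_curve_derivative[OF d(2) e un(2)]
    unfolding s0 by blast
  note ds = d[unfolded ab]
  have eq: "torus_map (s x, t x) = \<gamma> x" if "x \<in> {-e<..<e}" for x
  proof -
    have "\<gamma> x \<in> torus" using \<gamma>(1) that by blast
    from torus_map_inv[OF this] show ?thesis by (simp add: s_def t_def torus_inv_def)
  qed
  have nth: "((\<lambda>x. torus_map (s x, t x) $ j) has_vector_derivative v $ j) (at 0)" for j
  proof (rule has_vector_derivative_transform_within_open)
    show "((\<lambda>x. \<gamma> x $ j) has_vector_derivative v $ j) (at 0)"
      by (rule bounded_linear.has_vector_derivative[OF bounded_linear_vec_nth \<gamma>(3)])
    show "open {-e<..<e}" "0 \<in> {-e<..<e}" using e by auto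
  qed (simp add: eq)
  have "v $ 1 = 3 * \<i> * \<sigma>\<^sup>2 * (2 * complex_of_real a * (4 * \<tau> + cnj \<tau> - 6) + complex_of_real b * (4 * \<tau> - cnj \<tau>))"
  proof (rule vector_derivative_unique_at[OF nth[of 1]])
    show "((\<lambda>x. torus_map (s x, t x) $ 1) has_vector_derivative
       3 * \<i> * \<sigma>\<^sup>2 * (2 * complex_of_real a * (4 * \<tau> + cnj \<tau> - 6) + complex_of_real b * (4 * \<tau> - cnj \<tau>))) (at 0)"
      unfolding torus_map_nth
      by (rule derivative_eq_intros ds has_vector_derivative_cnj refl
          has_vector_derivative_mult has_vector_derivative_mult_right has_vector_derivative_diff)+
        (simp add: s0 algebra_simps power2_eq_square)
  qed
  moreover have "v $ 2 = \<i> * (cnj \<sigma>)\<^sup>2 * (- 2 * complex_of_real a * (4 * \<tau> + cnj \<tau> - 54) + complex_of_real b * (4 * \<tau> - cnj \<tau>))"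
  proof (rule vector_derivative_unique_at[OF nth[of 2]])
    show "((\<lambda>x. torus_map (s x, t x) $ 2) has_vector_derivative
       \<i> * (cnj \<sigma>)\<^sup>2 * (- 2 * complex_of_real a * (4 * \<tau> + cnj \<tau> - 54) + complex_of_real b * (4 * \<tau> - cnj \<tau>))) (at 0)"
      unfolding torus_map_nth
      by (rule derivative_eq_intros ds has_vector_derivative_cnj refl
          has_vector_derivative_mult has_vector_derivative_mult_right has_vector_derivative_diff)+
        (simp add: s0 algebra_simps power2_eq_square)
  qed
  moreover have "v $ 3 = 4 * \<i> * \<sigma> * (complex_of_real a * (4 * \<tau> - cnj \<tau>) + complex_of_real b * (4 * \<tau> + cnj \<tau>))"
  proof (rule vector_derivative_unique_at[OF nth[of 3]])
    show "((\<lambda>x. torus_map (s x, t x) $ 3) has_vector_derivative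
       4 * \<i> * \<sigma> * (complex_of_real a * (4 * \<tau> - cnj \<tau>) + complex_of_real b * (4 * \<tau> + cnj \<tau>))) (at 0)"
      unfolding torus_map_nth
      by (rule derivative_eq_intros ds has_vector_derivative_cnj refl
          has_vector_derivative_mult has_vector_derivative_mult_right has_vector_derivative_diff)+
        (simp add: s0 algebra_simps power2_eq_square)
  qed
  ultimately show ?thesis by blast
qed

lemma isotropic_torus: "isotropic torus"
  unfolding isotropic_def
proof (intro ballI)
  fix p v w assume p: "p \<in> torus" and vw: "v \<in> tangent_space torus p" "w \<in> tangent_space torus p"
  from p obtain \<sigma> \<tau> where st: "cmod \<sigma> = 1" "cmod \<tau> = 1" "p = torus_map (\<sigma>, \<tau>)" by (rule torusE)
  define s t where "s = cnj \<sigma>" and "t = cnj \<tau>"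
  have ss: "\<sigma> * s = 1" using st by (simp add: s_def unit_mult_cnj)
  obtain a b :: real where v:
     "v $ 1 = 3 * \<i> * \<sigma>\<^sup>2 * (2 * complex_of_real a * (4 * \<tau> + t - 6) + complex_of_real b * (4 * \<tau> - t))"
     "v $ 2 = \<i> * s\<^sup>2 * (- 2 * complex_of_real a * (4 * \<tau> + t - 54) + complex_of_real b * (4 * \<tau> - t))"
     "v $ 3 = 4 * \<i> * \<sigma> * (complex_of_real a * (4 * \<tau> - t) + complex_of_real b * (4 * \<tau> + t))"
    using tangent_space_torus[OF vw(1)[unfolded st(3)] st(1,2)] unfolding s_def t_def by blast
  obtain c d :: real where w:
     "w $ 1 = 3 * \<i> * \<sigma>\<^sup>2 * (2 * complex_of_real c * (4 * \<tau> + t - 6) + complex_of_real d * (4 * \<tau> - t))"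
     "w $ 2 = \<i> * s\<^sup>2 * (- 2 * complex_of_real c * (4 * \<tau> + t - 54) + complex_of_real d * (4 * \<tau> - t))"
     "w $ 3 = 4 * \<i> * \<sigma> * (complex_of_real c * (4 * \<tau> - t) + complex_of_real d * (4 * \<tau> + t))"
    using tangent_space_torus[OF vw(2)[unfolded st(3)] st(1,2)] unfolding s_def t_def by blast
  define A B C D where "A = complex_of_real a" and "B = complex_of_real b"
    and "C = complex_of_real c" and "D = complex_of_real d"
  have cj: "cnj A = A" "cnj B = B" "cnj C = C" "cnj D = D" "cnj \<sigma> = s" "cnj s = \<sigma>" "cnj \<tau> = t" "cnj t = \<tau>"
    by (auto simp: A_def B_def C_def D_def s_def t_def)
  \<comment> \<open>Each coordinate of v and w is linear in the velocities (A, B) and (C, D), so its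
    contribution to the alternating form is a multiple of the determinant
    \<open>A * D - B * C\<close>. The factor m is the weight of the circle action: 2, - 2 or
    1.\<close>
  have rule: "(e * x * (m * A * H + B * K)) * (e' * y * (m * C * H' + D * K'))
      - (e * x * (m * C * H + D * K)) * (e' * y * (m * A * H' + B * K'))
      = (x * y) * (e * e' * m * (A * D - B * C) * (H * K' - K * H'))" for e e' x y m H K H' K' :: complex
    by (simp add: algebra_simps)
  have 1: "v $ 1 * cnj (w $ 1) - w $ 1 * cnj (v $ 1) = (\<sigma>\<^sup>2 * s\<^sup>2) *
      (3 * \<i> * (3 * - \<i>) * 2 * (A * D - B * C) *
      ((4 * \<tau> + t - 6) * (4 * t - \<tau>) - (4 * \<tau> - t) * (4 * t + \<tau> - 6)))"
    unfolding rule[symmetric] v w A_def[symmetric] B_def[symmetric] C_def[symmetric] D_def[symmetric]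
    by (simp only: cj complex_cnj_mult complex_cnj_add complex_cnj_diff complex_cnj_power
        complex_cnj_numeral complex_cnj_i)
  have 2: "v $ 2 * cnj (w $ 2) - w $ 2 * cnj (v $ 2) = (s\<^sup>2 * \<sigma>\<^sup>2) *
      (\<i> * - \<i> * - 2 * (A * D - B * C) *
      ((4 * \<tau> + t - 54) * (4 * t - \<tau>) - (4 * \<tau> - t) * (4 * t + \<tau> - 54)))"
    unfolding rule[symmetric] v w A_def[symmetric] B_def[symmetric] C_def[symmetric] D_def[symmetric]
    by (simp only: cj complex_cnj_mult complex_cnj_add complex_cnj_diff complex_cnj_power
        complex_cnj_numeral complex_cnj_i complex_cnj_minus)
  have 3: "v $ 3 * cnj (w $ 3) - w $ 3 * cnj (v $ 3) = (\<sigma> * s) *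
      (4 * \<i> * (4 * - \<i>) * 1 * (A * D - B * C) *
      ((4 * \<tau> - t) * (4 * t + \<tau>) - (4 * \<tau> + t) * (4 * t - \<tau>)))"
    unfolding rule[symmetric] v w A_def[symmetric] B_def[symmetric] C_def[symmetric] D_def[symmetric]
    by (simp only: cj complex_cnj_mult complex_cnj_add complex_cnj_diff complex_cnj_power
        complex_cnj_numeral complex_cnj_i mult_1)
  have "\<sigma>\<^sup>2 * s\<^sup>2 = 1" "s\<^sup>2 * \<sigma>\<^sup>2 = 1"
    using ss by (metis mult.commute one_power2 power_mult_distrib)+
  note 123 = 1 2 3 this ss
  \<comment> \<open>Up to a common factor, the terms in \<open>t\<^sup>2 - \<tau>\<^sup>2\<close>
    cancel because 18 - 2 - 16 = 0, and those in \<open>\<tau> - t\<close> because 18 * 30 = 2 *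
    270.\<close>
  show "omega_st v w = 0"
    unfolding omega_st_def sum_3 123 by (simp add: algebra_simps)
qed

section \<open>Attached discs and the attached annulus\<close>

lemma max_modulus_disc:
  assumes "continuous_on (cball 0 1) g" "g holomorphic_on ball 0 1"
    "\<And>z. cmod z = 1 \<Longrightarrow> cmod (g z) \<le> B" "cmod z \<le> 1"
  shows "cmod (g z) \<le> B"
  by (rule maximum_modulus_frontier[of g "cball 0 1"]) (use assms in auto)

text \<open>The maximum principle for g and for 1 / g gives |g| \<le> R on the disc and |g 0| \<ge>
  R, so |g| attains its maximum at the centre.\<close>

lemma const_modulus_disc:
  assumes cont: "continuous_on (cball 0 1) g" and hol: "g holomorphic_on ball 0 1"
    and nz: "\<And>z. cmod z \<le> 1 \<Longrightarrow> g z \<noteq> 0" and bd: "\<And>z. cmod z = 1 \<Longrightarrow> cmod (g z) = R"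
    and z: "cmod z \<le> 1"
  shows "g z = g 0"
proof -
  have R: "R > 0" using nz[of 1] bd[of 1] by fastforce
  have le: "cmod (g z) \<le> R" if "cmod z \<le> 1" for z
    by (rule max_modulus_disc[OF cont hol _ that]) (simp add: bd)
  have "cmod (inverse (g 0)) \<le> inverse R"
  proof (rule max_modulus_disc[where g = "\<lambda>z. inverse (g z)" and z = 0])
    show "continuous_on (cball 0 1) (\<lambda>z. inverse (g z))"
      using nz by (intro continuous_on_inverse cont) auto
    show "(\<lambda>z. inverse (g z)) holomorphic_on ball 0 1"
      using nz by (intro holomorphic_on_inverse hol) auto
  qed (auto simp: bd norm_inverse)
  then have ge: "R \<le> cmod (g 0)" using R nz[of 0]
    by (simp add: norm_inverse)
  have "g constant_on ball 0 1"
  proof (rule maximum_modulus_principle[OF hol _ _ open_ball order_refl, of 0])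
    fix z :: complex assume "z \<in> ball 0 1"
    then have "cmod (g z) \<le> R" by (intro le) simp
    then show "cmod (g z) \<le> cmod (g 0)" using ge by linarith
  qed auto
  then obtain c where c: "\<And>z. z \<in> ball 0 1 \<Longrightarrow> g z = c" unfolding constant_on_def by blast
  have "g z = c"
    using continuous_constant_on_closure[of "ball 0 1" g c z] cont c z by simp
  then show ?thesis using c[of 0] by simp
qed

text \<open>This allows identities between holomorphic functions to be checked on the circle, where
  the parameters \<sigma> and \<tau> are available.\<close>

lemma vanish_on_circle_disc:
  assumes "continuous_on (cball 0 1) g" "g holomorphic_on ball 0 1"
    "\<And>z. cmod z = 1 \<Longrightarrow> g z = 0" "cmod z \<le> 1"
  shows "g z = 0"
  using max_modulus_disc[OF assms(1,2) _ assms(4), of 0] assms(3) by simp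

lemma unit_norm_bound: "cmod \<tau> = 1 \<Longrightarrow> cmod (4 * \<tau> + cnj \<tau>) \<le> 5"
  using norm_triangle_ineq[of "4 * \<tau>" "cnj \<tau>"] by (simp add: norm_mult)

text \<open>
  On the torus \<open>z\<^sub>1 z\<^sub>2 = 3 (h - 6) (h - 54)\<close> with \<open>h = 4 \<tau> + cnj \<tau>\<close>; solving this quadratic
  recovers \<open>h\<close> as a holomorphic function on the disc, because the values of
  \<open>W = z\<^sub>1 z\<^sub>2 / 3 + 576 = (30 - h)\<^sup>2\<close> stay in the right half plane. In the proof \<open>q\<close> extends
  \<open>cnj \<sigma> ^ 2\<close> and \<open>X\<close> is a root of \<open>X + 4 / X = h\<close>, so that on the circle \<open>X = 4 \<tau>\<close> or
  \<open>X = cnj \<tau>\<close>.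
\<close>

lemma disc_constant:
  fixes f1 f2 f3 :: "complex \<Rightarrow> complex"
  assumes cont: "continuous_on (cball 0 1) f1" "continuous_on (cball 0 1) f2" "continuous_on (cball 0 1) f3"
    and hol: "f1 holomorphic_on ball 0 1" "f2 holomorphic_on ball 0 1" "f3 holomorphic_on ball 0 1"
    and bd: "\<And>z. cmod z = 1 \<Longrightarrow> \<exists>\<sigma> \<tau>. cmod \<sigma> = 1 \<and> cmod \<tau> = 1 \<and>
        f1 z = 3 * (\<sigma> * \<sigma> * (4 * \<tau> + cnj \<tau> - 6)) \<and>
        f2 z = cnj \<sigma> * cnj \<sigma> * (4 * \<tau> + cnj \<tau> - 54) \<and>
        f3 z = 4 * (\<sigma> * (4 * \<tau> - cnj \<tau>))"
    and z: "cmod z \<le> 1"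
  shows "f1 z = f1 0 \<and> f2 z = f2 0 \<and> f3 z = f3 0"
proof -
  \<comment> \<open>The parameters are chosen pointwise, without any continuity in z. Continuity is
    used only for functions built from \<open>f1\<close>, \<open>f2\<close>,
    \<open>f3\<close>.\<close>
  obtain \<sigma> \<tau> where st0: "\<And>z. cmod z = 1 \<Longrightarrow> cmod (\<sigma> z) = 1 \<and> cmod (\<tau> z) = 1 \<and>
        f1 z = 3 * (\<sigma> z * \<sigma> z * (4 * \<tau> z + cnj (\<tau> z) - 6)) \<and>
        f2 z = cnj (\<sigma> z) * cnj (\<sigma> z) * (4 * \<tau> z + cnj (\<tau> z) - 54) \<and>
        f3 z = 4 * (\<sigma> z * (4 * \<tau> z - cnj (\<tau> z)))"
    using bd by metis
  define s t where "s z = cnj (\<sigma> z)" and "t z = cnj (\<tau> z)" for z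
  have n: "cmod (\<sigma> z) = 1" "cmod (\<tau> z) = 1" "cmod (s z) = 1" "cmod (t z) = 1"
    and ss: "\<sigma> z * s z = 1" and tt: "\<tau> z * t z = 1"
    and f: "f1 z = 3 * (\<sigma> z * \<sigma> z * (4 * \<tau> z + t z - 6))"
      "f2 z = s z * s z * (4 * \<tau> z + t z - 54)" "f3 z = 4 * (\<sigma> z * (4 * \<tau> z - t z))"
    and h5: "cmod (4 * \<tau> z + t z) \<le> 5"
    if "cmod z = 1" for z
    using st0[OF that] unit_norm_bound by (auto simp: s_def t_def unit_mult_cnj)

  define W where "W z = f1 z * f2 z / 3 + 576" for z
  have W: "continuous_on (cball 0 1) W" "W holomorphic_on ball 0 1"
    unfolding W_def[abs_def] by (intro continuous_intros holomorphic_intros cont hol; simp)+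
  have Wb: "W z = (30 - (4 * \<tau> z + t z))\<^sup>2" if "cmod z = 1" for z
  proof -
    have "W z = (\<sigma> z * s z)\<^sup>2 * ((4 * \<tau> z + t z - 6) * (4 * \<tau> z + t z - 54)) + 576"
      unfolding W_def f[OF that] by (simp add: power2_eq_square)
    then show ?thesis unfolding ss[OF that] by (simp add: power2_eq_square algebra_simps)
  qed
  \<comment> \<open>On the circle W - 900 = h^2 - 60 * h with |h| \<le> 5, whence 325 = 5^2 + 60 *
    5. As 325 < 900, W has positive real part.\<close>
  have "cmod (W z - 900) \<le> 325" if "cmod z \<le> 1" for z
  proof (rule max_modulus_disc[OF _ _ _ that])
    fix z :: complex assume z: "cmod z = 1"
    have "W z - 900 = (4 * \<tau> z + t z)\<^sup>2 - 60 * (4 * \<tau> z + t z)"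
      unfolding Wb[OF z] by (simp add: power2_eq_square algebra_simps)
    also have "cmod \<dots> \<le> cmod (4 * \<tau> z + t z) ^ 2 + 60 * cmod (4 * \<tau> z + t z)"
      by (metis norm_triangle_ineq4 norm_mult norm_numeral norm_power)
    also have "\<dots> \<le> 5\<^sup>2 + 60 * 5"
      using h5[OF z] by (intro add_mono power_mono mult_left_mono) auto
    finally show "cmod (W z - 900) \<le> 325" by simp
  qed (intro continuous_intros holomorphic_intros W)+
  then have Wpos: "0 < Re (W z)" if "cmod z \<le> 1" for z
    using abs_Re_le_cmod[of "W z - 900"] that by fastforce
  then have Wslit: "W z \<notin> \<real>\<^sub>\<le>\<^sub>0" if "cmod z \<le> 1" for z
    using that by (fastforce simp: complex_nonpos_Reals_iff)

  define h where "h z = 30 - csqrt (W z)" for z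
  have hc: "continuous_on (cball 0 1) h"
    unfolding h_def[abs_def] using Wslit
    by (intro continuous_intros continuous_on_compose2[OF continuous_on_csqrt W(1)]) auto
  have hh: "h holomorphic_on ball 0 1"
    unfolding h_def[abs_def] using Wslit by (intro holomorphic_intros W) auto
  have hb: "h z = 4 * \<tau> z + t z" if "cmod z = 1" for z
  proof -
    \<comment> \<open>This is the principal root because the real part of 30 - h is at least
      25.\<close>
    have "csqrt (W z) = 30 - (4 * \<tau> z + t z)"
      unfolding Wb[OF that]
      using h5[OF that] abs_Re_le_cmod[of "4 * \<tau> z + t z"] by (intro csqrt_square) auto
    then show ?thesis by (simp add: h_def)
  qed
  have h5': "cmod (h z) \<le> 5" if "cmod z \<le> 1" for z
    using max_modulus_disc[OF hc hh _ that] h5 hb by simp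
  then have hnz: "h z - 6 \<noteq> 0" "h z - 54 \<noteq> 0" if "cmod z \<le> 1" for z
    using that by fastforce+
  have prod: "f1 z * f2 z = 3 * ((h z - 6) * (h z - 54))" for z
  proof -
    have "(h z - 6) * (h z - 54) = (csqrt (W z))\<^sup>2 - 576"
      unfolding h_def by (simp add: power2_eq_square algebra_simps)
    then show ?thesis by (simp add: W_def mult.assoc mult.commute)
  qed

  define q where "q z = f2 z / (h z - 54)" for z
  have f2: "f2 z = q z * (h z - 54)" if "cmod z \<le> 1" for z
    using hnz[OF that] by (simp add: q_def)
  \<comment> \<open>A zero of q would be a zero of f2 and hence of f1 * f2, but h avoids 6 and
    54.\<close>
  have qnz: "q z \<noteq> 0" if "cmod z \<le> 1" for z
    using prod[of z] hnz[OF that] by (auto simp: q_def)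
  have qb: "q z = s z * s z" if "cmod z = 1" for z
    using hnz[of z] that unfolding q_def f(2)[OF that] hb[OF that] by simp
  have qc: "continuous_on (cball 0 1) q" unfolding q_def[abs_def]
    using hnz by (intro continuous_intros cont hc) auto
  have qh: "q holomorphic_on ball 0 1" unfolding q_def[abs_def]
    using hnz by (intro holomorphic_intros hol hh) auto
  have q: "q z = q 0" if "cmod z \<le> 1" for z
    by (rule const_modulus_disc[OF qc qh qnz _ that, where R = 1]) (auto simp: qb n norm_mult)
  \<comment> \<open>On the circle p is cnj \<sigma> up to a sign that may depend on the point. With
    this sign k equals 4 * \<tau> - cnj \<tau>, so X = (h + k) / 2 is 4 * \<tau> or cnj
    \<tau>.\<close>
  define p where "p = csqrt (q 0)"
  have p: "p\<^sup>2 = q 0" "p \<noteq> 0" using qnz[of 0] by (auto simp: p_def)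

  define k where "k z = f3 z * p / 4" for z
  have kc: "continuous_on (cball 0 1) k" and kh: "k holomorphic_on ball 0 1"
    unfolding k_def[abs_def] by (intro continuous_intros holomorphic_intros cont hol; simp)+
  \<comment> \<open>On the circle this is (4 * \<tau> + t)^2 - (4 * \<tau> - t)^2 = 16 * \<tau> * t
    = 16. It makes X zero-free, with 4 / X = (h - k) / 2.\<close>
  have kk: "(h z + k z) * (h z - k z) = 16" if "cmod z \<le> 1" for z
  proof -
    have "(h z + k z) * (h z - k z) - 16 = 0"
    proof (rule vanish_on_circle_disc[OF _ _ _ that])
      fix z :: complex assume z: "cmod z = 1"
      then have p2: "p\<^sup>2 = s z * s z" using qb[OF z] q[of z] p(1) by simp
      have "(h z + k z) * (h z - k z) - 16 = (h z)\<^sup>2 - p\<^sup>2 * (f3 z)\<^sup>2 / 16 - 16"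
        by (simp add: k_def field_simps power2_eq_square)
      also have "\<dots> = (4 * \<tau> z + t z)\<^sup>2 - (\<sigma> z * s z)\<^sup>2 * (4 * \<tau> z - t z)\<^sup>2 - 16"
        unfolding p2 hb[OF z] f(3)[OF z] by (simp add: power2_eq_square)
      also have "\<dots> = 16 * (\<tau> z * t z - 1)"
        unfolding ss[OF z] by (simp add: power2_eq_square algebra_simps)
      finally show "(h z + k z) * (h z - k z) - 16 = 0" using tt[OF z] by simp
    qed (intro continuous_intros holomorphic_intros kc kh hc hh)+
    then show ?thesis by simp
  qed

  define X where "X z = (h z + k z) / 2" for z
  have Xc: "continuous_on (cball 0 1) X" and Xh: "X holomorphic_on ball 0 1"
    unfolding X_def[abs_def] by (intro continuous_intros holomorphic_intros kc kh hc hh; simp)+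
  have Xnz: "X z \<noteq> 0" if "cmod z \<le> 1" for z
    using kk[OF that] by (auto simp: X_def)
  have Xb: "cmod (X z) \<in> {4, 1}" if z: "cmod z = 1" for z
  proof -
    have "(X z - 4 * \<tau> z) * (X z - t z) = (X z)\<^sup>2 - (4 * \<tau> z + t z) * X z + 4 * (\<tau> z * t z)"
      by (simp add: power2_eq_square algebra_simps)
    also have "\<dots> = (X z)\<^sup>2 - h z * X z + 4"
      unfolding tt[OF z] hb[OF z] by simp
    also have "\<dots> = (16 - (h z + k z) * (h z - k z)) / 4"
      by (simp add: X_def power2_eq_square field_simps)
    finally have "X z = 4 * \<tau> z \<or> X z = t z" using kk[of z] z by simp
    then show ?thesis using n[OF z] by (auto simp: norm_mult)
  qed
  have "(\<lambda>z. cmod (X z)) constant_on sphere 0 1"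
  proof (rule continuous_finite_range_constant)
    show "connected (sphere (0::complex) 1)" by (simp add: connected_sphere)
    show "continuous_on (sphere 0 1) (\<lambda>z. cmod (X z))"
      by (intro continuous_intros continuous_on_subset[OF Xc]) auto
    show "finite ((\<lambda>z. cmod (X z)) ` sphere 0 1)"
    proof (rule finite_subset)
      show "(\<lambda>z. cmod (X z)) ` sphere 0 1 \<subseteq> {4, 1}"
        by (intro image_subsetI Xb) simp
    qed simp
  qed
  then obtain R where R: "\<And>z. cmod z = 1 \<Longrightarrow> cmod (X z) = R"
    by (auto simp: constant_on_def)
  have X: "X z = X 0" using const_modulus_disc[OF Xc Xh Xnz R z] .
  have "h w - k w = 8 / X w" if "cmod w \<le> 1" for w
    using kk[OF that] Xnz[OF that] by (simp add: X_def field_simps)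
  then have "h z - k z = h 0 - k 0" using X z by simp
  moreover have "h z + k z = h 0 + k 0" using X unfolding X_def by (metis divide_cancel_right zero_neq_numeral)
  moreover have "a = c \<and> b = d" if "a - b = c - d" "a + b = c + d" for a b c d :: complex
    using that by (auto simp: complex_eq_iff)
  ultimately have hk: "h z = h 0" "k z = k 0" by blast+
  have "f2 z = f2 0" using f2[OF z] f2[of 0] q[OF z] hk by simp
  moreover have "f3 z = f3 0" using hk(2) p by (simp add: k_def)
  moreover have "f1 z = f1 0"
  proof -
    have "f2 0 \<noteq> 0" using f2[of 0] qnz[of 0] hnz[of 0] by simp
    then show ?thesis using prod[of z] prod[of 0] hk \<open>f2 z = f2 0\<close> by (metis mult_right_cancel)
  qed
  ultimately show ?thesis by blast
qed

lemma no_attached_disc: "\<not> attached_holomorphic_disc torus f"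
proof
  assume "attached_holomorphic_disc torus f"
  then obtain F where hol: "\<And>j. (\<lambda>\<zeta>. f \<zeta> $ j) holomorphic_on ball 0 1"
    and nc: "\<not> f constant_on ball 0 1" and F: "continuous_on (cball 0 1) F"
      "\<And>\<zeta>. \<zeta> \<in> ball 0 1 \<Longrightarrow> F \<zeta> = f \<zeta>" "F ` sphere 0 1 \<subseteq> torus"
    unfolding attached_holomorphic_disc_def by blast
  have c: "continuous_on (cball 0 1) (\<lambda>z. F z $ j)" for j
    by (intro continuous_intros F)
  have h: "(\<lambda>z. F z $ j) holomorphic_on ball 0 1" for j
    using hol[of j] by (rule holomorphic_transform) (simp add: F)
  have F0: "F z = F 0" if "cmod z \<le> 1" for z
  proof -
    have "F z $ 1 = F 0 $ 1 \<and> F z $ 2 = F 0 $ 2 \<and> F z $ 3 = F 0 $ 3"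
    proof (rule disc_constant[OF c c c h h h _ that])
      fix z :: complex assume "cmod z = 1"
      then have "F z \<in> torus" using F(3) by auto
      then show "\<exists>\<sigma> \<tau>. cmod \<sigma> = 1 \<and> cmod \<tau> = 1 \<and>
        F z $ 1 = 3 * (\<sigma> * \<sigma> * (4 * \<tau> + cnj \<tau> - 6)) \<and>
        F z $ 2 = cnj \<sigma> * cnj \<sigma> * (4 * \<tau> + cnj \<tau> - 54) \<and>
        F z $ 3 = 4 * (\<sigma> * (4 * \<tau> - cnj \<tau>))"
        by (elim torusE) (metis torus_map_nth)
    qed
    then show ?thesis by (simp add: vec_eq_iff forall_3)
  qed
  have "f z = F 0" if "z \<in> ball 0 1" for z
    using F0[of z] F(2)[OF that] that by simp
  then have "f constant_on ball 0 1" unfolding constant_on_def by blast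
  with nc show False by contradiction
qed

section \<open>The annulus in the polynomial hull\<close>

lemma holomorphic_on_polynomial:
  assumes "holomorphic_polynomial P" "\<And>j. (\<lambda>x. g x $ j) holomorphic_on S"
  shows "(\<lambda>x. P (g x)) holomorphic_on S"
proof -
  obtain A c where "P = (\<lambda>z. \<Sum>\<alpha>\<in>A. c \<alpha> * (\<Prod>j\<in>UNIV. (z $ j) ^ \<alpha> j))"
    using assms(1) unfolding holomorphic_polynomial_def by blast
  moreover have "(\<lambda>x. \<Sum>\<alpha>\<in>A. c \<alpha> * (\<Prod>j\<in>UNIV. (g x $ j) ^ \<alpha> j)) holomorphic_on S"
    by (intro holomorphic_intros assms(2))
  ultimately show ?thesis by simp
qed

lemma continuous_on_polynomial:
  assumes "holomorphic_polynomial P"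
  shows "continuous_on S P"
proof -
  obtain A c where "P = (\<lambda>z. \<Sum>\<alpha>\<in>A. c \<alpha> * (\<Prod>j\<in>UNIV. (z $ j) ^ \<alpha> j))"
    using assms unfolding holomorphic_polynomial_def by blast
  moreover have "continuous_on S \<dots>" by (intro continuous_intros)
  ultimately show ?thesis by simp
qed

text \<open>The inner boundary circle lies on the torus through \<open>\<sigma> = - 1\<close>.\<close>

definition annulus_map :: "complex \<Rightarrow> complex ^ 3" where
  "annulus_map X = vector [3 * (X + 4 / X - 6), X + 4 / X - 54, 4 * (X - 4 / X)]"

lemma annulus_map_boundary:
  assumes "cmod X = 4 \<or> cmod X = 1"
  shows "annulus_map X \<in> torus"
  using assms
proof
  assume X: "cmod X = 4"
  define \<tau> where "\<tau> = X / 4"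
  have \<tau>: "cmod \<tau> = 1" "X = 4 * \<tau>" using X by (auto simp: \<tau>_def norm_divide)
  then have "4 / X = cnj \<tau>" using unit_mult_cnj[OF \<tau>(1)] by (auto simp: divide_eq_eq mult.commute)
  then have "annulus_map X = torus_map (1, \<tau>)"
    by (simp add: annulus_map_def torus_map_def \<tau>)
  then show ?thesis using torusI[of 1 \<tau>] \<tau> by simp
next
  assume X: "cmod X = 1"
  have "X \<noteq> 0" using X by auto
  then have "4 / X = 4 * cnj X" using unit_mult_cnj[OF X] by (auto simp: divide_eq_eq mult.commute)
  then have "annulus_map X = torus_map (-1, cnj X)"
    by (simp add: annulus_map_def torus_map_def algebra_simps)
  then show ?thesis using torusI[of "-1" "cnj X"] X by simp
qed

lemma not_polynomially_convex_torus: "\<not> polynomially_convex torus"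
proof
  assume pc: "polynomially_convex torus"
  \<comment> \<open>The point 2 is fixed by X \<mapsto> 4 / X, so k vanishes there, whereas the
    torus does not meet the plane of vanishing third coordinate.\<close>
  have "annulus_map 2 $ 3 = 0" by (simp add: annulus_map_def)
  moreover have "z $ 3 \<noteq> 0" if "z \<in> torus" for z
    using that unit_four_diff_nonzero by (auto elim!: torusE)
  ultimately have "annulus_map 2 \<notin> torus" by blast
  then obtain P where P: "holomorphic_polynomial P"
    "cmod (P (annulus_map 2)) > (SUP x\<in>torus. cmod (P x))"
    using pc unfolding polynomially_convex_def by blast
  have "compact ((\<lambda>x. cmod (P x)) ` torus)"
    by (intro compact_continuous_image continuous_intros continuous_on_polynomial P compact_torus)
  \<comment> \<open>A real \<open>SUP\<close> is known to dominate the values only if these are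
    bounded above.\<close>
  then have bdd: "bdd_above ((\<lambda>x. cmod (P x)) ` torus)"
    by (intro bounded_imp_bdd_above compact_imp_bounded)
  define A where "A = cball (0::complex) 4 - ball 0 1"
  have A: "closed A" "bounded A" by (auto simp: A_def)
  have int: "interior A \<subseteq> A" by (rule interior_subset)
  have hol: "(\<lambda>X. P (annulus_map X)) holomorphic_on A"
  proof (rule holomorphic_on_polynomial[OF P(1)])
    fix j :: 3
    have "\<forall>j. (\<lambda>x. annulus_map x $ j) holomorphic_on A"
      unfolding forall_3 annulus_map_def by (auto intro!: holomorphic_intros simp: A_def)
    then show "(\<lambda>x. annulus_map x $ j) holomorphic_on A" by blast
  qed
  have "cmod (P (annulus_map 2)) \<le> (SUP x\<in>torus. cmod (P x))"
  proof (rule maximum_modulus_frontier[of "\<lambda>X. P (annulus_map X)" A])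
    show "(\<lambda>X. P (annulus_map X)) holomorphic_on interior A"
      by (rule holomorphic_on_subset[OF hol int])
    show "continuous_on (closure A) (\<lambda>X. P (annulus_map X))"
      using holomorphic_on_imp_continuous_on[OF hol] A by simp
    show "bounded A" "2 \<in> A" using A by (auto simp: A_def)
    fix X assume "X \<in> frontier A"
    then have X: "X \<in> A" "X \<notin> interior A" using A by (auto simp: frontier_def)
    have "ball 0 4 - cball 0 1 \<subseteq> interior A"
      by (rule interior_maximal) (auto simp: A_def open_Diff)
    then have "cmod X = 4 \<or> cmod X = 1" using X by (force simp: A_def)
    then show "cmod (P (annulus_map X)) \<le> (SUP x\<in>torus. cmod (P x))"
      by (intro cSUP_upper annulus_map_boundary bdd)
  qed
  with P(2) show False by simp
qed

section \<open>Real-analytic charts\<close>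

lemma real_analytic_on_add:
  assumes "f real_analytic_on U" "g real_analytic_on U"
  shows "(\<lambda>x. f x + g x) real_analytic_on U"
  unfolding real_analytic_on_def
proof
  fix p assume p: "p \<in> U"
  obtain r c where f: "r > 0" "\<And>x. x \<in> ball p r \<Longrightarrow>
      ((\<lambda>\<alpha>. (\<Prod>b\<in>Basis. ((x - p) \<bullet> b) ^ \<alpha> b) *\<^sub>R c \<alpha>) has_sum f x) (Basis \<rightarrow>\<^sub>E UNIV)"
    using assms(1) p unfolding real_analytic_on_def by blast
  obtain s d where g: "s > 0" "\<And>x. x \<in> ball p s \<Longrightarrow>
      ((\<lambda>\<alpha>. (\<Prod>b\<in>Basis. ((x - p) \<bullet> b) ^ \<alpha> b) *\<^sub>R d \<alpha>) has_sum g x) (Basis \<rightarrow>\<^sub>E UNIV)"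
    using assms(2) p unfolding real_analytic_on_def by blast
  have "((\<lambda>\<alpha>. (\<Prod>b\<in>Basis. ((x - p) \<bullet> b) ^ \<alpha> b) *\<^sub>R (c \<alpha> + d \<alpha>)) has_sum f x + g x) (Basis \<rightarrow>\<^sub>E UNIV)"
    if "x \<in> ball p (min r s)" for x
    unfolding scaleR_add_right using that by (intro has_sum_add f g) auto
  then show "\<exists>r>0. \<exists>c. \<forall>x\<in>ball p r.
      ((\<lambda>\<alpha>. (\<Prod>b\<in>Basis. ((x - p) \<bullet> b) ^ \<alpha> b) *\<^sub>R c \<alpha>) has_sum f x + g x) (Basis \<rightarrow>\<^sub>E UNIV)"
    using f(1) g(1) by (intro exI[of _ "min r s"] conjI exI[of _ "\<lambda>\<alpha>. c \<alpha> + d \<alpha>"]) auto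
qed

lemma real_analytic_on_bounded_linear_compose:
  assumes L: "bounded_linear L" and "f real_analytic_on U"
  shows "(\<lambda>x. L (f x)) real_analytic_on U"
  unfolding real_analytic_on_def
proof
  fix p assume p: "p \<in> U"
  obtain r c where f: "r > 0" "\<And>x. x \<in> ball p r \<Longrightarrow>
      ((\<lambda>\<alpha>. (\<Prod>b\<in>Basis. ((x - p) \<bullet> b) ^ \<alpha> b) *\<^sub>R c \<alpha>) has_sum f x) (Basis \<rightarrow>\<^sub>E UNIV)"
    using assms(2) p unfolding real_analytic_on_def by blast
  have "((\<lambda>\<alpha>. (\<Prod>b\<in>Basis. ((x - p) \<bullet> b) ^ \<alpha> b) *\<^sub>R L (c \<alpha>)) has_sum L (f x)) (Basis \<rightarrow>\<^sub>E UNIV)"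
    if "x \<in> ball p r" for x
    using has_sum_bounded_linear[OF L f(2)[OF that]] by (simp add: linear_simps[OF L])
  then show "\<exists>r>0. \<exists>c. \<forall>x\<in>ball p r.
      ((\<lambda>\<alpha>. (\<Prod>b\<in>Basis. ((x - p) \<bullet> b) ^ \<alpha> b) *\<^sub>R c \<alpha>) has_sum L (f x)) (Basis \<rightarrow>\<^sub>E UNIV)"
    using f(1) by (intro exI[of _ r] conjI exI[of _ "\<lambda>\<alpha>. L (c \<alpha>)"]) auto
qed

text \<open>Absolute summability of both factors makes the double family summable, so its sum may be
  computed iteratively.\<close>

lemma has_sum_mult_Times:
  fixes f :: "'a \<Rightarrow> 'c::{real_normed_field, banach}" and g :: "'b \<Rightarrow> 'c"
  assumes f: "(f has_sum F) A" "(\<lambda>x. norm (f x)) summable_on A" and g: "(g has_sum G) B" "(\<lambda>y. norm (g y)) summable_on B"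
  shows "((\<lambda>(x, y). f x * g y) has_sum F * G) (A \<times> B)"
proof (rule has_sum_SigmaI)
  show "((\<lambda>y. (case (x, y) of (x, y) \<Rightarrow> f x * g y)) has_sum f x * G) B" for x
    using has_sum_cmult_right[OF g(1)] by simp
  show "((\<lambda>x. f x * G) has_sum F * G) A"
    by (rule has_sum_cmult_left[OF f(1)])
  have "(\<lambda>z. norm (case z of (x, y) \<Rightarrow> f x * g y)) summable_on (A \<times> B)"
    unfolding Infinite_Sum.abs_summable_on_Sigma_iff
  proof (intro conjI ballI)
    show "(\<lambda>y. norm (case (x, y) of (x, y) \<Rightarrow> f x * g y)) summable_on B" for x
      using summable_on_cmult_right[OF g(2)] by (simp add: norm_mult)
    show "(\<lambda>x. norm (\<Sum>\<^sub>\<infinity>y\<in>B. norm (case (x, y) of (x, y) \<Rightarrow> f x * g y))) summable_on A"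
      using summable_on_cmult_left[OF f(2)] g(2)
      by (simp add: norm_mult infsum_cmult_right' abs_mult infsum_nonneg)
  qed
  then show "(\<lambda>(x, y). f x * g y) summable_on A \<times> B"
    by (rule abs_summable_summable)
qed

text \<open>This translates the multi-indices of \<open>real_analytic_on\<close>, which are
  functions on \<open>Basis\<close>, into pairs of exponents, as they occur in a product of two
  power series.\<close>

lemma bij_betw_multiindex_plane:
  "bij_betw (\<lambda>\<alpha>. (\<alpha> (1, 0), \<alpha> (0, 1))) ((Basis :: (real \<times> real) set) \<rightarrow>\<^sub>E (UNIV :: 'c set)) (UNIV \<times> UNIV)"
proof -
  have B: "(Basis :: (real \<times> real) set) = {(1, 0), (0, 1)}"
    by (auto simp: Basis_prod_def)
  define A where "A = {(1::real, 0::real), (0, 1)}"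
  show ?thesis
    unfolding B A_def[symmetric]
  proof (rule bij_betwI[where g = "\<lambda>(m, n). restrict (\<lambda>b. if b = (1, 0) then m else n) A"])
    fix \<alpha> :: "real \<times> real \<Rightarrow> 'c" assume "\<alpha> \<in> A \<rightarrow>\<^sub>E UNIV"
    then show "(case (\<alpha> (1, 0), \<alpha> (0, 1)) of (m, n) \<Rightarrow>
        restrict (\<lambda>b. if b = (1, 0) then m else n) A) = \<alpha>"
      unfolding prod.case by (intro extensionalityI[of _ A]) (auto simp: A_def PiE_def)
  next
    show "(\<lambda>(m, n). restrict (\<lambda>b. if b = (1, 0) then m else n) A) \<in> UNIV \<times> UNIV \<rightarrow> A \<rightarrow>\<^sub>E (UNIV :: 'c set)"
      by (intro funcsetI) (simp only: split_beta restrict_PiE_iff UNIV_I ball_triv simp_thms)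
  qed (simp_all add: A_def split_beta)
qed

lemma norm_summable_on_exp_series:
  fixes z :: complex
  shows "(\<lambda>n. norm (z ^ n /\<^sub>R fact n)) summable_on UNIV"
  by (rule summable_nonneg_imp_summable_on[OF summable_norm_exp]) simp

lemma has_sum_exp:
  fixes z :: complex
  shows "((\<lambda>n. z ^ n /\<^sub>R fact n) has_sum exp z) UNIV"
  by (rule norm_summable_imp_has_sum[OF summable_norm_exp exp_converges])

definition cis_prod :: "real \<Rightarrow> real \<Rightarrow> real \<times> real \<Rightarrow> complex" where
  "cis_prod a b p = cis (a * fst p) * cis (b * snd p)"

text \<open>The functional equation of \<open>exp\<close> splits off the value at p and leaves a
  product of two exponential series in the increments u and v.\<close>

lemma real_analytic_on_cis_prod: "cis_prod a b real_analytic_on U"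
  unfolding real_analytic_on_def
proof
  fix p :: "real \<times> real"
  define c where "c \<alpha> = cis_prod a b p *
    (((\<i> * a) ^ \<alpha> (1, 0) /\<^sub>R fact (\<alpha> (1, 0))) * ((\<i> * b) ^ \<alpha> (0, 1) /\<^sub>R fact (\<alpha> (0, 1))))"
    for \<alpha> :: "real \<times> real \<Rightarrow> nat"
  have hs: "((\<lambda>\<alpha>. (\<Prod>b\<in>Basis. ((x - p) \<bullet> b) ^ \<alpha> b) *\<^sub>R c \<alpha>) has_sum cis_prod a b x) (Basis \<rightarrow>\<^sub>E UNIV)" for x
  proof -
    define u v where "u = \<i> * a * (fst x - fst p)" and "v = \<i> * b * (snd x - snd p)"
    have x: "cis_prod a b x = cis_prod a b p * (exp u * exp v)"
      by (simp add: cis_prod_def cis_conv_exp u_def v_def mult_exp_exp algebra_simps)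
    have monomial: "(\<Prod>b\<in>Basis. ((x - p) \<bullet> b) ^ \<alpha> b) *\<^sub>R c \<alpha> =
        cis_prod a b p * ((u ^ \<alpha> (1, 0) /\<^sub>R fact (\<alpha> (1, 0))) * (v ^ \<alpha> (0, 1) /\<^sub>R fact (\<alpha> (0, 1))))"
      for \<alpha> :: "real \<times> real \<Rightarrow> nat"
      by (simp add: Basis_prod_def c_def u_def v_def power_mult_distrib scaleR_conv_of_real inner_prod_def)
    have "((\<lambda>\<alpha>. case (\<alpha> (1, 0), \<alpha> (0, 1)) of (m, n) \<Rightarrow> (u ^ m /\<^sub>R fact m) * (v ^ n /\<^sub>R fact n))
        has_sum exp u * exp v) ((Basis :: (real \<times> real) set) \<rightarrow>\<^sub>E (UNIV :: nat set))"
      by (subst has_sum_reindex_bij_betw[OF bij_betw_multiindex_plane])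
        (intro has_sum_mult_Times has_sum_exp norm_summable_on_exp_series)
    from has_sum_cmult_right[OF this, of "cis_prod a b p"]
    show ?thesis unfolding monomial x by simp
  qed
  show "\<exists>r>0. \<exists>c. \<forall>x\<in>ball p r.
      ((\<lambda>\<alpha>. (\<Prod>b\<in>Basis. ((x - p) \<bullet> b) ^ \<alpha> b) *\<^sub>R c \<alpha>) has_sum cis_prod a b x) (Basis \<rightarrow>\<^sub>E UNIV)"
    \<comment> \<open>The series converges on the whole plane, so any radius serves.\<close>
    by (intro exI[of _ "1::real"] exI[of _ c] conjI ballI hs zero_less_one)
qed

section \<open>Angles as local coordinates on the torus\<close>

definition torus_chart :: "real \<times> real \<Rightarrow> complex ^ 3" where
  "torus_chart p = torus_map (cis (fst p), cis (snd p))"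

text \<open>Conjugation negates a frequency, so the coordinates are trigonometric polynomials. The
  trivial factor 1 gives every summand the shape \<open>axis j (k * w)\<close>, a linear image of a
  \<open>cis_prod\<close>.\<close>

lemma torus_chart_cis_prod:
  "torus_chart p =
     axis 1 (12 * cis_prod 2 1 p) + axis 1 (3 * cis_prod 2 (-1) p) + axis 1 (-18 * cis_prod 2 0 p) +
     axis 2 (4 * cis_prod (-2) 1 p) + axis 2 (1 * cis_prod (-2) (-1) p) + axis 2 (-54 * cis_prod (-2) 0 p) +
     axis 3 (16 * cis_prod 1 1 p) + axis 3 (-4 * cis_prod 1 (-1) p)"
proof -
  define s t where "s = cis (fst p)" and "t = cis (snd p)"
  have e: "cis_prod 2 1 p = s * s * t" "cis_prod 2 (-1) p = s * s * cnj t" "cis_prod 2 0 p = s * s"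
    "cis_prod (-2) 1 p = cnj s * cnj s * t" "cis_prod (-2) (-1) p = cnj s * cnj s * cnj t"
    "cis_prod (-2) 0 p = cnj s * cnj s" "cis_prod 1 1 p = s * t" "cis_prod 1 (-1) p = s * cnj t"
    unfolding cis_prod_def s_def t_def cis_cnj cis_mult by (simp_all add: algebra_simps)
  show ?thesis
    unfolding vec_eq_iff forall_3 torus_chart_def e s_def[symmetric] t_def[symmetric]
    by (simp add: axis_def algebra_simps)
qed

lemma real_analytic_on_torus_chart: "torus_chart real_analytic_on U"
proof -
  have "bounded_linear (\<lambda>w. axis j (k * w) :: complex ^ 3)" for j k
    by (intro bounded_linear_compose[OF bounded_linear_axis] bounded_linear_mult_right)
  note lin = real_analytic_on_bounded_linear_compose[OF this real_analytic_on_cis_prod]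
  show ?thesis
    unfolding torus_chart_cis_prod[abs_def] by (intro real_analytic_on_add lin)
qed

lemma torus_chart_in_torus: "torus_chart p \<in> torus"
  unfolding torus_chart_def by (rule torusI) auto

lemma torus_inv_chart: "torus_inv (torus_chart p) = (cis (fst p), cis (snd p))"
  unfolding torus_chart_def by (rule torus_inv_map) auto

lemma has_derivative_cis_pair:
  "((\<lambda>p. (cis (fst p), cis (snd p))) has_derivative
     (\<lambda>h. (\<i> * cis (fst p) * of_real (fst h), \<i> * cis (snd p) * of_real (snd h)))) (at p)"
proof -
  have "(cis has_derivative (\<lambda>h. \<i> * cis x * of_real h)) (at x)" for x
    using has_derivative_cis[OF has_derivative_ident, of x UNIV]
    by (simp add: scaleR_conv_of_real mult.commute)
  note d = has_derivative_compose[OF _ this]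
  show ?thesis
    by (intro has_derivative_Pair d[OF bounded_linear_imp_has_derivative[OF bounded_linear_fst]]
        d[OF bounded_linear_imp_has_derivative[OF bounded_linear_snd]])
qed

text \<open>Composing with the left inverse \<open>torus_inv\<close> gives the pair of maps
  \<open>cis\<close>, whose derivative is injective; by the chain rule the derivative of
  \<open>torus_chart\<close> is injective too.\<close>

lemma torus_chart_immersion: "\<exists>f'. (torus_chart has_derivative f') (at p) \<and> inj f'"
proof -
  obtain T' where T': "(torus_map has_derivative T') (at (cis (fst p), cis (snd p)))"
    using has_derivative_smooth[OF smooth_torus_map UNIV_I] by blast
  define f' where "f' = (\<lambda>h. T' (\<i> * cis (fst p) * of_real (fst h), \<i> * cis (snd p) * of_real (snd h)))"
  have f': "(torus_chart has_derivative f') (at p)"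
    unfolding torus_chart_def[abs_def] f'_def by (rule has_derivative_compose[OF has_derivative_cis_pair T'])
  have "torus_chart p \<in> torus_nbhd" using torus_chart_in_torus torus_subset_nbhd by blast
  then obtain L where L: "(torus_inv has_derivative L) (at (torus_chart p))"
    using has_derivative_smooth[OF smooth_torus_inv] by blast
  have "((\<lambda>q. (cis (fst q), cis (snd q))) has_derivative (\<lambda>h. L (f' h))) (at p)"
    using has_derivative_compose[OF f' L] unfolding torus_inv_chart .
  note D = fun_cong[OF has_derivative_unique[OF this has_derivative_cis_pair]]
  have eq: "L (f' h) = (\<i> * cis (fst p) * of_real (fst h), \<i> * cis (snd p) * of_real (snd h))" for h
    by (rule D)
  have "inj f'"
  proof (rule injI)
    fix h k assume "f' h = f' k"
    then have "L (f' h) = L (f' k)" by simp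
    then show "h = k" unfolding eq by (simp add: prod_eq_iff)
  qed
  with f' show ?thesis by blast
qed

text \<open>Since cis x is unimodular, s * cnj (cis x) is the quotient s / cis x. Taking its
  argument moves the branch cut of \<open>Arg\<close> to the side of the circle opposite to cis
  x.\<close>

lemma local_arg:
  assumes "cmod s = 1" "0 < Re (s * cnj (cis x))"
  shows "cis (x + Arg (s * cnj (cis x))) = s" "\<bar>Arg (s * cnj (cis x))\<bar> < pi / 2"
proof -
  have "cis (Arg (s * cnj (cis x))) = s * cnj (cis x)"
    using assms by (subst cis_Arg) (auto simp: sgn_div_norm norm_mult)
  then show "cis (x + Arg (s * cnj (cis x))) = s"
    using unit_mult_cnj[of "cis x"] unfolding cis_mult[symmetric] by (simp add: mult.left_commute)
  show "\<bar>Arg (s * cnj (cis x))\<bar> < pi / 2" using assms(2) Arg_Re_pos by blast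
qed

text \<open>On \<open>U\<close> the quotients \<open>a\<close> and \<open>b\<close> lie in the right
  half plane, where \<open>Arg\<close> is continuous, so \<open>g\<close> recovers the angles
  continuously. The half-width pi / 2 of \<open>W\<close> matches this condition, because cos is
  positive exactly there among angles up to pi.\<close>

lemma real_analytic_surface_torus: "real_analytic_surface torus"
  unfolding real_analytic_surface_def
proof
  fix p assume p: "p \<in> torus"
  then obtain \<sigma> \<tau> where st: "cmod \<sigma> = 1" "cmod \<tau> = 1" "p = torus_map (\<sigma>, \<tau>)" by (rule torusE)
  define x y where "x = Arg \<sigma>" and "y = Arg \<tau>"
  have xy: "\<sigma> = cis x" "\<tau> = cis y"
    using st cis_Arg[of \<sigma>] cis_Arg[of \<tau>] by (fastforce simp: x_def y_def sgn_div_norm)+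
  define W where "W = {x - pi/2 <..< x + pi/2} \<times> {y - pi/2 <..< y + pi/2}"
  have W_iff: "q \<in> W \<longleftrightarrow> \<bar>fst q - x\<bar> < pi / 2 \<and> \<bar>snd q - y\<bar> < pi / 2" for q
    unfolding W_def mem_Times_iff greaterThanLessThan_iff abs_less_iff by argo
  define a b where "a z = sigma_coord z * cnj (cis x)" and "b z = tau_coord z * cnj (cis y)" for z
  define U where "U = torus_nbhd \<inter> (\<lambda>z. (a z, b z)) -` ({z. 0 < Re z} \<times> {z. 0 < Re z})"
  define g where "g z = (x + Arg (a z), y + Arg (b z))" for z
  have "continuous_on torus_nbhd torus_inv"
    using continuous_on_smooth[OF smooth_torus_inv] .
  from continuous_on_fst[OF this] continuous_on_snd[OF this]
  have ab: "continuous_on torus_nbhd a" "continuous_on torus_nbhd b"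
    unfolding a_def[abs_def] b_def[abs_def] torus_inv_def
    by (auto intro!: continuous_on_mult_right)
  have Uo: "open U" unfolding U_def
    using smooth_torus_inv
    by (intro continuous_open_preimage continuous_on_Pair ab open_Times open_halfspace_Re_gt)
      (simp add: smooth_on_open_def)
  have Re_cis: "0 < Re (cis s * cnj (cis t)) \<and> Arg (cis s * cnj (cis t)) = s - t"
    if "\<bar>s - t\<bar> < pi / 2" for s t
  proof -
    have eq: "cis s * cnj (cis t) = cis (s - t)" by (simp add: cis_cnj cis_mult)
    have "Arg (cis (s - t)) = s - t"
    proof (rule cis_Arg_unique)
      show "- pi < s - t" "s - t \<le> pi" using that pi_gt_zero unfolding abs_less_iff by linarith+
    qed (simp add: sgn_div_norm)
    moreover have "0 < cos (s - t)" using that by (intro cos_gt_zero_pi) (unfold abs_less_iff, linarith+)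
    ultimately show ?thesis unfolding eq by simp
  qed
  have abc: "a (torus_chart q) = cis (fst q) * cnj (cis x)" "b (torus_chart q) = cis (snd q) * cnj (cis y)" for q
    using torus_inv_chart[of q] by (auto simp: a_def b_def torus_inv_def)
  have "homeomorphism W (torus \<inter> U) torus_chart g"
  proof (rule homeomorphismI)
    show "continuous_on W torus_chart"
      by (meson continuous_at_imp_continuous_on has_derivative_continuous torus_chart_immersion)
    have "a z \<notin> \<real>\<^sub>\<le>\<^sub>0 \<and> b z \<notin> \<real>\<^sub>\<le>\<^sub>0" if "z \<in> U" for z
      using that by (auto simp: U_def complex_nonpos_Reals_iff)
    moreover have "continuous_on U a" "continuous_on U b"
      using ab by (auto simp: U_def intro: continuous_on_subset)
    ultimately have "continuous_on U g" unfolding g_def[abs_def]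
      by (intro continuous_intros continuous_on_compose2[OF continuous_on_Arg]) auto
    then show "continuous_on (torus \<inter> U) g" by (rule continuous_on_subset) simp
    show gf: "g (torus_chart q) = q" if "q \<in> W" for q
    proof -
      have "\<bar>fst q - x\<bar> < pi / 2" "\<bar>snd q - y\<bar> < pi / 2"
        using that W_iff by blast+
      then show ?thesis using Re_cis by (simp add: g_def abc)
    qed
    have "torus_chart q \<in> torus \<inter> U" if "q \<in> W" for q
    proof -
      have "\<bar>fst q - x\<bar> < pi / 2" "\<bar>snd q - y\<bar> < pi / 2"
        using that W_iff by blast+
      then have "0 < Re (a (torus_chart q))" "0 < Re (b (torus_chart q))"
        using Re_cis by (simp_all only: abc)
      then show ?thesis
        using torus_chart_in_torus[of q] subsetD[OF torus_subset_nbhd torus_chart_in_torus[of q]]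
        by (simp add: U_def)
    qed
    then show "torus_chart ` W \<subseteq> torus \<inter> U" by blast
    have z: "torus_chart (g z) = z \<and> g z \<in> W" if "z \<in> torus \<inter> U" for z
    proof -
      have pos: "0 < Re (a z)" "0 < Re (b z)" using that by (auto simp: U_def)
      have un: "cmod (sigma_coord z) = 1" "cmod (tau_coord z) = 1"
        using cmod_coords that by blast+
      note s = local_arg[OF un(1) pos(1)[unfolded a_def]] and t = local_arg[OF un(2) pos(2)[unfolded b_def]]
      have "torus_chart (g z) = torus_map (torus_inv z)"
        unfolding torus_chart_def g_def torus_inv_def a_def b_def fst_conv snd_conv s(1) t(1) ..
      then have "torus_chart (g z) = z" using torus_map_inv that by simp
      moreover have "g z \<in> W"
        using s(2) t(2) by (simp add: W_iff g_def a_def b_def)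
      ultimately show ?thesis by blast
    qed
    then show "g ` (torus \<inter> U) \<subseteq> W" by blast
    show "torus_chart (g z) = z" if "z \<in> torus \<inter> U" for z using z[OF that] by blast
  qed
  moreover have "open W" by (auto simp: W_def intro: open_Times)
  moreover have "p \<in> U"
  proof -
    have "p = torus_chart (x, y)" by (simp add: torus_chart_def st xy)
    then have "a p = 1" "b p = 1" using abc[of "(x, y)"] by (simp_all add: unit_mult_cnj)
    then show ?thesis using p torus_subset_nbhd by (auto simp: U_def)
  qed
  ultimately show "\<exists>U W f g. open U \<and> p \<in> U \<and> open W \<and> f real_analytic_on W \<and>
        (\<forall>u\<in>W. \<exists>f'. (f has_derivative f') (at u) \<and> inj f') \<and>
        homeomorphism W (torus \<inter> U) (f :: real \<times> real \<Rightarrow> _) g"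
    using Uo real_analytic_on_torus_chart torus_chart_immersion by blast
qed

theorem theorem1:
  shows "\<exists>T :: (complex ^ 3) set.
    compact T \<and> real_analytic_surface T \<and>
    diffeomorphic (sphere (0::complex) 1 \<times> sphere (0::complex) 1) T \<and>
    isotropic T \<and>
    \<not> polynomially_convex T \<and>
    \<not> (\<exists>f. attached_holomorphic_disc T f)"
  using compact_torus real_analytic_surface_torus diffeomorphic_torus isotropic_torus
    not_polynomially_convex_torus no_attached_disc by blast

end
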